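(* There exists $n_0$ such that for every integer $n>n_0$ the following holds. Let $m=\binom{n}{2}$ and $M=\lceil m/2\rceil$. Let $\mathcal{G}$ be the set of all connected graphs on vertex set $[n]=\{1,\dots,n\}$, partially ordered by $G<H$ iff $E(G)\subsetneq E(H)$, and let $\mathcal{G}^{(M)}=\{G\in\mathcal{G}: |E(G)|=M\}$. Then $\mathcal{G}^{(M)}$ is an antichain of maximum size in $(\mathcal{G},<)$, i.e. every antichain $\mathcal{A}\subseteq\mathcal{G}$ satisfies $|\mathcal{A}|\le|\mathcal{G}^{(M)}|$.
   Context: Graphs are simple. An antichain in a poset is a set of pairwise incomparable elements. *)

theory Defs
  imports Complex_Main
begin

text \<open>
  The vertex set is fixed throughout, so a graph on \<open>V\<close> is identified with its set of edges,
  an edge being a two-element subset of \<open>V\<close>.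
\<close>

definition simple_graph_on :: "'a set \<Rightarrow> 'a set set \<Rightarrow> bool" where
  "simple_graph_on V E \<longleftrightarrow> (\<forall>e\<in>E. e \<subseteq> V \<and> card e = 2)"

definition graph_connected :: "'a set \<Rightarrow> 'a set set \<Rightarrow> bool" where
  "graph_connected V E \<longleftrightarrow> V \<noteq> {} \<and> (\<forall>u\<in>V. \<forall>v\<in>V. (u, v) \<in> {(x, y). {x, y} \<in> E}\<^sup>*)"

definition connected_graphs :: "nat \<Rightarrow> nat set set set" where
  "connected_graphs n = {E. simple_graph_on {1..n} E \<and> graph_connected {1..n} E}"

definition connected_graphs_level :: "nat \<Rightarrow> nat \<Rightarrow> nat set set set" where
  "connected_graphs_level n k = {E \<in> connected_graphs n. card E = k}"

definition antichain_in :: "'a set \<Rightarrow> ('a \<Rightarrow> 'a \<Rightarrow> bool) \<Rightarrow> 'a set \<Rightarrow> bool" where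
  "antichain_in P lt A \<longleftrightarrow>
     A \<subseteq> P \<and> (\<forall>x\<in>A. \<forall>y\<in>A. x \<noteq> y \<longrightarrow> \<not> lt x y \<and> \<not> lt y x)"

text \<open>
  Sizes are compared by \<^const>\<open>card\<close>, which is meaningful for \<^const>\<open>connected_graphs\<close> because
  there are only finitely many graphs on \<open>{1..n}\<close>.
\<close>

lemma finite_connected_graphs: "finite (connected_graphs n)"
proof (rule finite_subset)
  show "connected_graphs n \<subseteq> Pow (Pow {1..n})"
    by (auto simp: connected_graphs_def simple_graph_on_def)
qed simp

end

theory Submission
  imports Defs
begin

text \<open>
  An antichain is pushed into level \<open>M\<close> one level at a time, replacing its extreme level by the shadow
  of that level inside the connected graphs. Going up, degree counting suffices, since adding an edge
  keeps a graph connected. Going down from level \<open>k\<close>, a graph with \<open>b\<close> bridges has only \<open>k - b\<close>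
  connected neighbours, which may be fewer than the \<open>K = m - k + 1\<close> upper neighbours of a graph below
  it. The plain weight \<open>1/K\<close> on each edge of the level graph is therefore raised to \<open>(1 + 1.1 b/K)/K\<close>
  when both ends have \<open>b\<close> bridges and lowered to \<open>(1 - 3/(2n))/K\<close> when their numbers of bridges
  differ. The total arriving at a graph with \<open>b\<close> bridges stays at most 1, because about \<open>b n\<close> of
  the possible new edges destroy a bridge; the total leaving a graph stays at least 1, because at most
  \<open>2n/3\<close> of its edges are bridges or create a bridge when deleted. Both counts come
  from splitting the vertex set along cuts with at most two edges: a graph with at least \<open>m/2\<close>
  edges can be split in this way at most \<open>n/3\<close> times.
\<close>

section \<open>Cuts, connectivity and bridges\<close>

text \<open>Applied to edges, to parts and to the whole vertex set alike: \<open>crosses S V\<close>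
  says that the cut given by \<open>S\<close> has both sides nonempty in \<open>V\<close>.\<close>

definition crosses :: "'a set \<Rightarrow> 'a set \<Rightarrow> bool" where
  "crosses S e \<longleftrightarrow> e \<inter> S \<noteq> {} \<and> e - S \<noteq> {}"

definition edge_cut :: "'a set set \<Rightarrow> 'a set \<Rightarrow> 'a set set" where
  "edge_cut E S = {e \<in> E. crosses S e}"

text \<open>Connectivity in terms of cuts, so that bridges become one-edge cuts. It holds vacuously
  for empty \<open>V\<close>, hence the extra conjunct in
  \<open>graph_connected_iff\<close>.\<close>

definition no_empty_cut :: "'a set \<Rightarrow> 'a set set \<Rightarrow> bool" where
  "no_empty_cut V E \<longleftrightarrow> (\<forall>S. crosses S V \<longrightarrow> edge_cut E S \<noteq> {})"

definition pairs :: "'a set \<Rightarrow> 'a set set" where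
  "pairs X = {p. p \<subseteq> X \<and> card p = 2}"

text \<open>The usual bridges if \<open>E\<close> is connected; otherwise every edge
  qualifies.\<close>

definition bridges :: "'a set \<Rightarrow> 'a set set \<Rightarrow> 'a set set" where
  "bridges V E = {f \<in> E. \<not> no_empty_cut V (E - {f})}"

lemma finite_pairs: "finite X \<Longrightarrow> finite (pairs X)"
  by (rule finite_subset[of _ "Pow X"]) (auto simp: pairs_def)

lemma card_pairs: "finite X \<Longrightarrow> card (pairs X) = card X choose 2"
  by (simp add: pairs_def n_subsets)

lemma simple_graph_on_iff: "simple_graph_on V E \<longleftrightarrow> E \<subseteq> pairs V"
  by (auto simp: simple_graph_on_def pairs_def)

lemma graph_connected_iff:
  assumes E: "E \<subseteq> pairs V"
  shows "graph_connected V E \<longleftrightarrow> V \<noteq> {} \<and> no_empty_cut V E"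
proof (intro iffI conjI)
  assume *: "graph_connected V E"
  then show "V \<noteq> {}" by (simp add: graph_connected_def)
  show "no_empty_cut V E"
    unfolding no_empty_cut_def
  proof (intro allI impI notI)
    fix S assume "crosses S V" and empty: "edge_cut E S = {}"
    then obtain u v where u: "u \<in> V" "u \<in> S" and v: "v \<in> V" "v \<notin> S"
      by (auto simp: crosses_def)
    have "(u, v) \<in> {(x, y). {x, y} \<in> E}\<^sup>*"
      using * u v by (auto simp: graph_connected_def)
    then have "v \<in> S"
    proof (induction rule: rtrancl_induct)
      case base
      show ?case by fact
    next
      case (step y z)
      then show ?case using empty by (auto simp: edge_cut_def crosses_def)
    qed
    with v show False by simp
  qed
next
  assume *: "V \<noteq> {} \<and> no_empty_cut V E"
  show "graph_connected V E"
    unfolding graph_connected_def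
  proof (intro conjI ballI)
    show "V \<noteq> {}" using * by simp
    fix u v assume u: "u \<in> V" and v: "v \<in> V"
    define R where "R = {(x, y). {x, y} \<in> E}"
    \<comment> \<open>The component of \<open>u\<close>. By connectivity across cuts some edge would
      leave it, but such an edge extends a walk from \<open>u\<close>.\<close>
    define S where "S = {x. (u, x) \<in> R\<^sup>*}"
    have "v \<in> S"
    proof (rule ccontr)
      assume "v \<notin> S"
      moreover have "u \<in> S" by (simp add: S_def)
      ultimately have "crosses S V" using u v by (auto simp: crosses_def)
      then obtain e where e: "e \<in> E" "crosses S e"
        using * by (auto simp: no_empty_cut_def edge_cut_def)
      then obtain x y where xy: "x \<in> e" "x \<in> S" "y \<in> e" "y \<notin> S"
        by (auto simp: crosses_def)
      have "card e = 2" using e E by (auto simp: pairs_def)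
      then have "e = {x, y}" using xy by (auto simp: card_2_iff)
      then have "(x, y) \<in> R" using e by (simp add: R_def)
      then have "y \<in> S" using xy by (auto simp: S_def intro: rtrancl_into_rtrancl)
      with xy show False by simp
    qed
    then show "(u, v) \<in> {(x, y). {x, y} \<in> E}\<^sup>*" by (simp add: S_def R_def)
  qed
qed

lemma no_empty_cut_mono: "no_empty_cut V E \<Longrightarrow> E \<subseteq> F \<Longrightarrow> no_empty_cut V F"
  unfolding no_empty_cut_def edge_cut_def by blast

lemma edge_cut_remove: "edge_cut (E - {f}) S = edge_cut E S - {f}"
  by (auto simp: edge_cut_def)

text \<open>Deleting \<open>f\<close> leaves some cut empty; that cut was nonempty before, so
  \<open>f\<close> was its only edge.\<close>

lemma bridge_cut:
  assumes "no_empty_cut V E" "f \<in> bridges V E"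
  obtains S where "crosses S V" "edge_cut E S = {f}"
proof -
  obtain S where S: "crosses S V" "edge_cut (E - {f}) S = {}"
    using assms by (auto simp: bridges_def no_empty_cut_def)
  then have "edge_cut E S = {f}"
    using assms(1) by (auto simp: edge_cut_remove no_empty_cut_def)
  with S that show ?thesis by blast
qed

section \<open>Splitting the vertex set along small cuts\<close>

text \<open>Two cliques sharing one vertex lie in a clique on \<open>x + y - 1\<close> vertices. The
  lost vertex pays for one split in the structure lemma below.\<close>

lemma choose_two_merge:
  fixes x y :: nat
  assumes "x \<ge> 1" "y \<ge> 1"
  shows "(x choose 2) + (y choose 2) \<le> (x + y - 1) choose 2"
proof -
  have gen: "(Suc x choose 2) + (Suc y choose 2) \<le> Suc (x + y) choose 2" for x y :: nat
    by (induction y) (auto simp: numeral_2_eq_2)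
  show ?thesis
    using gen assms by (cases x; cases y) auto
qed

text \<open>
  Splitting \<open>X\<close> along a cut of the family exposes at most \<open>j\<close> further covered edges while it
  raises the number of parts by one; \<open>q\<close> counts the splits until no cut separates any part.
\<close>

lemma small_cuts_structure:
  assumes "finite X" "X \<noteq> {}" "finite E" "\<And>S. S \<in> C \<Longrightarrow> card (edge_cut E S) \<le> j"
  shows "\<exists>q < card X. card {e \<in> E. e \<subseteq> X \<and> (\<exists>S\<in>C. crosses S e)} \<le> j * q \<and>
           card {p \<in> pairs X. \<forall>S\<in>C. \<not> crosses S p} \<le> (card X - q) choose 2"
  using assms(1,2)
proof (induction "card X" arbitrary: X rule: less_induct)
  case less
  define cov where "cov X = {e \<in> E. e \<subseteq> X \<and> (\<exists>S\<in>C. crosses S e)}" for X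
  define sep where "sep X = {p \<in> pairs X. \<forall>S\<in>C. \<not> crosses S p}" for X
  have fin_cov: "finite (cov Y)" for Y using \<open>finite E\<close> by (simp add: cov_def)
  show ?case
  proof (cases "\<exists>S\<in>C. crosses S X")
    case False
    then have "cov X = {}" unfolding cov_def crosses_def by blast
    moreover have "card (sep X) \<le> card X choose 2"
      using card_mono[of "pairs X" "sep X"] less.prems
      by (auto simp: finite_pairs card_pairs sep_def)
    ultimately show ?thesis
      using less.prems by (intro exI[of _ 0]) (auto simp: cov_def sep_def card_gt_0_iff)
  next
    case True
    then obtain S where S: "S \<in> C" "crosses S X" by blast
    define Y Z where "Y = X \<inter> S" and "Z = X - S"
    have YZ: "Y \<noteq> {}" "Z \<noteq> {}" "X = Y \<union> Z" "Y \<inter> Z = {}" "finite Y" "finite Z"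
      using S less.prems by (auto simp: Y_def Z_def crosses_def)
    have cX: "card X = card Y + card Z"
      using YZ by (simp add: card_Un_disjoint)
    have pos: "card Y > 0" "card Z > 0" using YZ by (auto simp: card_gt_0_iff)
    \<comment> \<open>Strictness of \<open>q < card Y\<close> keeps \<open>card Y - q\<close>
      positive, as the merging of the binomials requires; likewise for \<open>Z\<close>.\<close>
    obtain q where q: "q < card Y" "card (cov Y) \<le> j * q" "card (sep Y) \<le> (card Y - q) choose 2"
      using less.hyps[of Y] cX pos YZ unfolding cov_def sep_def by auto
    obtain r where r: "r < card Z" "card (cov Z) \<le> j * r" "card (sep Z) \<le> (card Z - r) choose 2"
      using less.hyps[of Z] cX pos YZ unfolding cov_def sep_def by auto
    have "cov X \<subseteq> cov Y \<union> cov Z \<union> edge_cut E S"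
      by (auto simp: cov_def edge_cut_def crosses_def Y_def Z_def)
    then have "card (cov X) \<le> card (cov Y \<union> cov Z \<union> edge_cut E S)"
      using \<open>finite E\<close> by (intro card_mono) (auto simp: fin_cov edge_cut_def)
    also have "\<dots> \<le> card (cov Y) + card (cov Z) + card (edge_cut E S)"
      by (meson add_le_mono card_Un_le order.trans order_refl)
    also have "\<dots> \<le> j * q + j * r + j"
      using q(2) r(2) assms(4)[OF S(1)] by linarith
    finally have 1: "card (cov X) \<le> j * (q + r + 1)" by (simp add: algebra_simps)
    have "sep X \<subseteq> sep Y \<union> sep Z"
      using S(1) by (auto simp: sep_def pairs_def crosses_def Y_def Z_def)
    then have "card (sep X) \<le> card (sep Y \<union> sep Z)"
      using YZ by (intro card_mono) (auto simp: sep_def finite_pairs)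
    also have "\<dots> \<le> card (sep Y) + card (sep Z)" by (rule card_Un_le)
    also have "\<dots> \<le> ((card Y - q) choose 2) + ((card Z - r) choose 2)"
      using q(3) r(3) by linarith
    also have "\<dots> \<le> ((card Y - q) + (card Z - r) - 1) choose 2"
      using q(1) r(1) by (intro choose_two_merge) auto
    also have "(card Y - q) + (card Z - r) - 1 = card X - (q + r + 1)"
      using q(1) r(1) cX by simp
    finally have 2: "card (sep X) \<le> (card X - (q + r + 1)) choose 2" .
    show ?thesis
      using 1 2 q(1) r(1) cX unfolding cov_def sep_def
      by (intro exI[of _ "q + r + 1"]) auto
  qed
qed

lemma real_choose_two: "real (n choose 2) = real n * (real n - 1) / 2"
proof -
  have "even (n * (n - 1))" by auto
  then have "real (n * (n - 1) div 2) = real (n * (n - 1)) / 2"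
    by (simp add: real_of_nat_div)
  then show ?thesis by (cases n) (auto simp: choose_two algebra_simps)
qed

text \<open>Every edge is covered by a cut of the family or is an unseparated pair, so
  \<open>card E\<close> is at most \<open>2 * q + ((n - q) choose 2)\<close>. For
  \<open>q > n / 3\<close> this is at most about \<open>2 / 9 * n * n\<close>, less than the roughly
  \<open>n * n / 4\<close> edges that are present.\<close>

lemma dense_small_cuts_structure:
  assumes "finite V" "card V > 100" "E \<subseteq> pairs V" "2 * card E \<ge> card V choose 2"
    and "\<And>S. S \<in> C \<Longrightarrow> card (edge_cut E S) \<le> j" and "j \<le> 2"
  shows "\<exists>q. 3 * q \<le> card V \<and> card {e \<in> E. \<exists>S\<in>C. crosses S e} \<le> j * q \<and>
           card {p \<in> pairs V. \<forall>S\<in>C. \<not> crosses S p} \<le> (card V - q) choose 2"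
proof -
  define n where "n = card V"
  have finE: "finite E" using assms finite_pairs finite_subset by metis
  have "V \<noteq> {}" using assms(2) by auto
  then obtain q where q: "q < n"
      "card {e \<in> E. e \<subseteq> V \<and> (\<exists>S\<in>C. crosses S e)} \<le> j * q"
      "card {p \<in> pairs V. \<forall>S\<in>C. \<not> crosses S p} \<le> (n - q) choose 2"
    using small_cuts_structure[OF assms(1) _ finE assms(5)] unfolding n_def by blast
  have eq: "{e \<in> E. e \<subseteq> V \<and> (\<exists>S\<in>C. crosses S e)} = {e \<in> E. \<exists>S\<in>C. crosses S e}"
    using assms(3) by (auto simp: pairs_def)
  have "card E \<le> card ({e \<in> E. \<exists>S\<in>C. crosses S e} \<union> {p \<in> pairs V. \<forall>S\<in>C. \<not> crosses S p})"
    using assms(3) finE finite_pairs[OF assms(1)] by (intro card_mono) auto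
  also have "\<dots> \<le> j * q + ((n - q) choose 2)"
    using q(2,3) eq card_Un_le order.trans add_mono by (metis (no_types, lifting))
  also have "\<dots> \<le> 2 * q + ((n - q) choose 2)" using assms(6) by simp
  finally have "real (card E) \<le> 2 * real q + real ((n - q) choose 2)"
    by linarith
  moreover have "real (n choose 2) \<le> 2 * real (card E)"
    using assms(4) unfolding n_def by linarith
  ultimately have ineq: "real n * (real n - 1) / 4 \<le> 2 * real q + (real n - real q) * (real n - real q - 1) / 2"
    using q(1) by (simp add: real_choose_two of_nat_diff)
  have n100: "real n > 100" using assms(2) by (simp add: n_def)
  have "3 * real q \<le> real n"
  proof (rule ccontr)
    assume "\<not> 3 * real q \<le> real n"
    then have a: "real n - real q \<le> 2 / 3 * real n" "0 \<le> real n - real q" using q(1) by auto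
    have "(real n - real q) * (real n - real q - 1) \<le> (real n - real q) * (real n - real q)"
      using a by (intro mult_left_mono) auto
    also have "\<dots> \<le> (2 / 3 * real n) * (2 / 3 * real n)" using a by (intro mult_mono) auto
    finally have "real n * (real n - 1) / 4 \<le> 2 * real n + 2 / 9 * (real n * real n)"
      using ineq q(1) by linarith
    \<comment> \<open>Since \<open>1/4 - 2/9 = 1/36\<close>, the quadratic terms leave
      \<open>n * n / 36\<close> against \<open>9 / 4 * n\<close>.\<close>
    then have "real n * real n \<le> 81 * real n" by (simp add: algebra_simps)
    then show False using n100 by simp
  qed
  then have "3 * q \<le> n" by linarith
  then show ?thesis using q eq unfolding n_def by auto
qed

section \<open>Counting bridges and the edges that change their number\<close>

text \<open>A new edge is no bridge, since \<open>G\<close> connects everything without it; and a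
  deletion that disconnects the larger graph disconnects the smaller one.\<close>

lemma bridges_insert_subset:
  assumes "no_empty_cut V G"
  shows "bridges V (insert e G) \<subseteq> bridges V G"
proof
  fix f assume f: "f \<in> bridges V (insert e G)"
  have "f \<in> G"
  proof (rule ccontr)
    assume "f \<notin> G"
    then have "G \<subseteq> insert e G - {f}" using f by (auto simp: bridges_def)
    then show False using no_empty_cut_mono[OF assms] f by (auto simp: bridges_def)
  qed
  moreover have "\<not> no_empty_cut V (G - {f})"
    using f no_empty_cut_mono[of V "G - {f}" "insert e G - {f}"] by (auto simp: bridges_def)
  ultimately show "f \<in> bridges V G" by (simp add: bridges_def)
qed

text \<open>The one-edge cuts cover exactly the bridges, and a new edge across such a cut destroys
  its bridge. Removing from all pairs the \<open>b\<close> bridges and the at most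
  \<open>(n - b) choose 2\<close> pairs that cross no such cut leaves the killing pairs.\<close>

lemma card_bridges_and_killing_pairs:
  assumes V: "finite V" "card V > 100" and G: "G \<subseteq> pairs V" "2 * card G \<ge> card V choose 2"
    and conn: "no_empty_cut V G"
  defines "b \<equiv> card (bridges V G)"
  shows "3 * b \<le> card V"
    and "real b * (2 * real (card V) - real b - 3) / 2
      \<le> real (card {e \<in> pairs V - G. card (bridges V (insert e G)) \<noteq> b})"
proof -
  define n where "n = card V"
  define C where "C = {S. crosses S V \<and> (\<exists>f. edge_cut G S = {f})}"
  have finP: "finite (pairs V)" using V finite_pairs by blast
  have finG: "finite G" using finP G finite_subset by blast
  have small: "card (edge_cut G S) \<le> 1" if "S \<in> C" for S using that by (auto simp: C_def)
  obtain q where q: "3 * q \<le> n" "card {e \<in> G. \<exists>S\<in>C. crosses S e} \<le> q"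
      "card {p \<in> pairs V. \<forall>S\<in>C. \<not> crosses S p} \<le> (n - q) choose 2"
    using dense_small_cuts_structure[OF V G small] unfolding n_def by auto
  have br: "{e \<in> G. \<exists>S\<in>C. crosses S e} = bridges V G"
  proof (intro equalityI subsetI)
    fix e assume "e \<in> {e \<in> G. \<exists>S\<in>C. crosses S e}"
    then obtain S f where e: "e \<in> G" "crosses S e" "crosses S V" "edge_cut G S = {f}"
      by (auto simp: C_def)
    then have "edge_cut (G - {e}) S = {}" by (auto simp: edge_cut_def)
    then show "e \<in> bridges V G" using e by (auto simp: bridges_def no_empty_cut_def)
  next
    fix e assume e: "e \<in> bridges V G"
    then obtain S where S: "crosses S V" "edge_cut G S = {e}" using bridge_cut[OF conn] by blast
    then have "crosses S e" by (auto simp: edge_cut_def)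
    then show "e \<in> {e \<in> G. \<exists>S\<in>C. crosses S e}" using e S by (auto simp: C_def bridges_def)
  qed
  have bq: "b \<le> q" using q(2) unfolding br b_def .
  then show "3 * b \<le> card V" using q(1) n_def by simp
  define K where "K = {e \<in> pairs V - G. card (bridges V (insert e G)) \<noteq> b}"
  have killed: "e \<in> K" if e: "e \<in> pairs V" "e \<notin> G" "S \<in> C" "crosses S e" for e S
  proof -
    obtain f where S: "crosses S V" "edge_cut G S = {f}" using e(3) by (auto simp: C_def)
    have fG: "f \<in> G" "crosses S f" using S by (auto simp: edge_cut_def)
    have fb: "f \<in> bridges V G"
      using fG e(3) br by blast
    have fnot: "f \<notin> bridges V (insert e G)"
    proof
      assume "f \<in> bridges V (insert e G)"
      then have "\<not> no_empty_cut V (insert e G - {f})" by (auto simp: bridges_def)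
      then obtain T where T: "crosses T V" "edge_cut (insert e G - {f}) T = {}"
        by (auto simp: no_empty_cut_def)
      have Tf: "edge_cut G T = {f}"
        using T conn unfolding no_empty_cut_def edge_cut_def by blast
      have eT: "\<not> crosses T e" using T(2) e(2) fG(1) by (auto simp: edge_cut_def)
      have only: "g = f" if "g \<in> G" "crosses S g \<or> crosses T g" for g
        using that Tf S(2) by (auto simp: edge_cut_def)
      \<comment> \<open>The symmetric difference of \<open>S\<close> and \<open>T\<close> has an empty cut in \<open>G\<close>, so it is trivial.\<close>
      define D where "D = (S - T) \<union> (T - S)"
      have fT: "crosses T f" using Tf by (auto simp: edge_cut_def)
      have "\<not> crosses D g" if g: "g \<in> G" for g
      proof (cases "g = f")
        case True
        \<comment> \<open>The two ends of \<open>f\<close> differ both in membership of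
          \<open>S\<close> and in membership of \<open>T\<close>, so they agree about
          \<open>D\<close>.\<close>
        have "card f = 2" using fG G by (auto simp: pairs_def)
        then obtain x y where "f = {x, y}" by (auto simp: card_2_iff)
        then show ?thesis using True fT fG by (auto simp: D_def crosses_def)
      next
        case False
        then have "\<not> crosses S g" "\<not> crosses T g" using only g by auto
        then show ?thesis by (auto simp: D_def crosses_def)
      qed
      then have "edge_cut G D = {}" by (auto simp: edge_cut_def)
      then have D: "\<not> crosses D V" using conn by (auto simp: no_empty_cut_def)
      \<comment> \<open>\<open>e\<close> crosses \<open>S\<close> but not \<open>T\<close>, hence it
        crosses \<open>D\<close>, although \<open>D\<close> does not separate
        \<open>V\<close>.\<close>
      have "e \<subseteq> V" "card e = 2" using e by (auto simp: pairs_def)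
      then obtain x y where xy: "e = {x, y}" "x \<in> V" "y \<in> V" by (auto simp: card_2_iff)
      then show False using D eT e(4) by (auto simp: D_def crosses_def)
    qed
    have "bridges V (insert e G) \<subset> bridges V G"
      using bridges_insert_subset[OF conn, of e] fb fnot by blast
    then have "card (bridges V (insert e G)) < b"
      unfolding b_def using finG by (intro psubset_card_mono) (auto simp: bridges_def)
    then show ?thesis using e by (simp add: K_def)
  qed
  have "pairs V \<subseteq> {p \<in> pairs V. \<forall>S\<in>C. \<not> crosses S p} \<union> bridges V G \<union> K"
    using killed br by blast
  then have "card (pairs V) \<le> card ({p \<in> pairs V. \<forall>S\<in>C. \<not> crosses S p} \<union> bridges V G \<union> K)"
    using finP finG by (intro card_mono) (auto simp: K_def bridges_def)
  also have "\<dots> \<le> card {p \<in> pairs V. \<forall>S\<in>C. \<not> crosses S p} + card (bridges V G) + card K"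
    by (meson add_le_mono card_Un_le order.trans order_refl)
  also have "\<dots> \<le> ((n - q) choose 2) + b + card K" using q(3) by (simp add: b_def)
  \<comment> \<open>The number of splits \<open>q\<close> is at least \<open>b\<close>, so passing
    to \<open>b\<close> only enlarges the binomial and leaves a bound in \<open>b\<close>
    alone.\<close>
  also have "\<dots> \<le> ((n - b) choose 2) + b + card K"
    using bq by (intro add_right_mono binomial_right_mono) auto
  finally have "real (n choose 2) \<le> real ((n - b) choose 2) + real b + real (card K)"
    using card_pairs[OF V(1)] unfolding n_def by linarith
  then show "real b * (2 * real (card V) - real b - 3) / 2 \<le> real (card K)"
    using bq q(1) unfolding real_choose_two n_def[symmetric]
    by (simp add: of_nat_diff field_simps)
qed

text \<open>All edges counted lie in cuts with at most two edges: a bridge alone in its cut, and an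
  edge whose deletion creates a bridge \<open>f\<close> in a cut contained in \<open>{e, f}\<close>.
  Such cuts cover at most \<open>2 * q\<close> edges, with \<open>q\<close> at most a third of the
  vertices.\<close>

lemma card_bridges_and_new_bridge_edges:
  assumes V: "finite V" "card V > 100" and H: "H \<subseteq> pairs V" "2 * card H \<ge> card V choose 2"
    and conn: "no_empty_cut V H"
  defines "b \<equiv> card (bridges V H)"
  shows "3 * (b + card {e \<in> H - bridges V H. card (bridges V (H - {e})) \<noteq> b}) \<le> 2 * card V"
proof -
  define C where "C = {S. card (edge_cut H S) \<le> 2}"
  define N where "N = {e \<in> H - bridges V H. card (bridges V (H - {e})) \<noteq> b}"
  have finH: "finite H" using V H finite_subset finite_pairs by metis
  obtain q where q: "3 * q \<le> card V" "card {e \<in> H. \<exists>S\<in>C. crosses S e} \<le> 2 * q"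
    using dense_small_cuts_structure[OF V H, of C 2] by (auto simp: C_def)
  have "bridges V H \<union> N \<subseteq> {e \<in> H. \<exists>S\<in>C. crosses S e}"
  proof
    fix e assume "e \<in> bridges V H \<union> N"
    then consider "e \<in> bridges V H" | "e \<in> N" by blast
    then show "e \<in> {e \<in> H. \<exists>S\<in>C. crosses S e}"
    proof cases
      case 1
      then obtain S where S: "edge_cut H S = {e}" using bridge_cut[OF conn] by blast
      then have "e \<in> H" "crosses S e" by (auto simp: edge_cut_def)
      moreover have "S \<in> C" using S by (simp add: C_def)
      ultimately show ?thesis by blast
    next
      case 2
      then have e: "e \<in> H" "e \<notin> bridges V H" "card (bridges V (H - {e})) \<noteq> b"
        by (auto simp: N_def)
      then have conn': "no_empty_cut V (H - {e})" by (auto simp: bridges_def)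
      \<comment> \<open>Deletion loses no bridge of \<open>H\<close> here, so a changed number means
        that a new one appears.\<close>
      have "\<not> bridges V (H - {e}) \<subseteq> bridges V H"
        using bridges_insert_subset[OF conn', of e] e by (auto simp: b_def insert_absorb)
      then obtain f where f: "f \<in> bridges V (H - {e})" "f \<notin> bridges V H" by blast
      obtain S where S: "crosses S V" "edge_cut (H - {e}) S = {f}"
        using bridge_cut[OF conn' f(1)] by blast
      have "crosses S e"
      proof (rule ccontr)
        assume "\<not> crosses S e"
        then have "edge_cut (H - {f}) S = {}" using S(2) by (auto simp: edge_cut_def)
        then have "f \<in> bridges V H" using S f by (auto simp: bridges_def no_empty_cut_def)
        with f show False by simp
      qed
      moreover have "edge_cut H S \<subseteq> {e, f}" using S(2) by (auto simp: edge_cut_def)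
      then have "card (edge_cut H S) \<le> card {e, f}" by (intro card_mono) auto
      then have "S \<in> C" using card_insert_le_m1[of 2 "{f}" e] unfolding C_def by simp
      ultimately show ?thesis using e by auto
    qed
  qed
  then have "card (bridges V H \<union> N) \<le> 2 * q"
    using q(2) finH card_mono[of "{e \<in> H. \<exists>S\<in>C. crosses S e}" "bridges V H \<union> N"] by force
  moreover have "card (bridges V H \<union> N) = b + card N"
    unfolding b_def using finH by (intro card_Un_disjoint) (auto simp: N_def bridges_def)
  ultimately have "b + card N \<le> 2 * q" by simp
  then have "3 * (b + card N) \<le> 2 * card V" using q(1) by presburger
  then show ?thesis unfolding N_def .
qed

section \<open>Weighted double counting\<close>

text \<open>The total weight is at least \<open>card A\<close> when summed from \<open>A\<close>,
  and at most \<open>card T\<close> when summed from \<open>T\<close>.\<close>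

lemma card_le_card_if_weights:
  fixes w :: "'a \<Rightarrow> 'b \<Rightarrow> real"
  assumes "finite A" "finite T" "\<And>x. x \<in> A \<Longrightarrow> N x \<subseteq> T"
    and "\<And>x. x \<in> A \<Longrightarrow> 1 \<le> (\<Sum>y\<in>N x. w x y)"
    and "\<And>y. y \<in> T \<Longrightarrow> (\<Sum>x | x \<in> A \<and> y \<in> N x. w x y) \<le> 1"
  shows "card A \<le> card T"
proof -
  have "real (card A) \<le> (\<Sum>x\<in>A. \<Sum>y\<in>N x. w x y)"
    using sum_mono[of A "\<lambda>_. 1" "\<lambda>x. \<Sum>y\<in>N x. w x y"] assms(4) by simp
  also have "\<dots> = (\<Sum>x\<in>A. \<Sum>y | y \<in> T \<and> y \<in> N x. w x y)"
    using assms(3) by (intro sum.cong refl) auto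
  also have "\<dots> = (\<Sum>y\<in>T. \<Sum>x | x \<in> A \<and> y \<in> N x. w x y)"
    by (rule sum.swap_restrict[OF assms(1,2)])
  also have "\<dots> \<le> real (card T)"
    using sum_mono[of T "\<lambda>y. \<Sum>x | x \<in> A \<and> y \<in> N x. w x y" "\<lambda>_. 1"] assms(5) by simp
  finally show ?thesis by simp
qed

text \<open>Phrased through the exceptional set, whose size is what the bridge counts
  control.\<close>

lemma sum_if_const:
  fixes u v :: real
  assumes "finite A"
  shows "(\<Sum>x\<in>A. if P x then u else v) =
    (real (card A) - real (card {x \<in> A. \<not> P x})) * u + real (card {x \<in> A. \<not> P x}) * v"
proof -
  have "card A = card {x \<in> A. P x} + card {x \<in> A. \<not> P x}"
    using assms by (subst card_Un_disjoint[symmetric]) (auto intro!: arg_cong[of _ _ card])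
  moreover have "(\<Sum>x\<in>A. if P x then u else v) =
      real (card {x \<in> A. P x}) * u + real (card {x \<in> A. \<not> P x}) * v"
    using assms by (simp add: sum.If_cases Int_def)
  ultimately show ?thesis by simp
qed

text \<open>Compared with weight \<open>1 / K\<close> on all \<open>k\<close> edges and after
  scaling by \<open>K\<close>, the \<open>b\<close> bridges lose \<open>b\<close>, the raised
  weights win back at least \<open>b\<close>, and the \<open>c\<close> lowered ones cost at most 1
  because \<open>c \<le> 2 * n / 3\<close>. The slack \<open>k \<ge> K + 1\<close> pays for that
  1.\<close>

lemma outgoing_weight_ge_1:
  fixes n k K b c :: real
  assumes "n > 100" "K \<ge> 1" "k \<ge> K + 1" "k + K = n * (n - 1) / 2 + 1"
    and "b \<ge> 0" "c \<ge> 0" "3 * (b + c) \<le> 2 * n"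
  shows "1 \<le> (k - b - c) * ((1 + 11 / 10 * b / K) / K) + c * ((1 - 3 / (2 * n)) / K)"
proof -
  have nn: "n * n \<ge> 100 * n" using assms(1) by (intro mult_right_mono) auto
  have "10 * K \<le> 11 * (k - b - c)"
  \<comment> \<open>Up to \<open>8 * n\<close>, \<open>k\<close> is quadratic in \<open>n\<close>
    and dwarfs \<open>K\<close>. Beyond it, \<open>11 * k\<close> exceeds \<open>10 * K\<close> by
    more than \<open>K\<close>, which covers \<open>11 * (b + c) \<le> 22 / 3 * n\<close>.\<close>
  proof (cases "K \<le> 8 * n")
    case True
    have "n * (n - 1) / 2 = n * n / 2 - n / 2" by (simp add: field_simps)
    then show ?thesis using True nn assms by argo
  next
    case False
    then show ?thesis using assms by argo
  qed
  then have "10 * K * b \<le> 11 * (k - b - c) * b" using assms(5) by (rule mult_right_mono)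
  then have 1: "b \<le> (k - b - c) * (11 / 10 * b / K)"
    using assms(2) by (simp add: field_simps)
  have 2: "c * (3 / (2 * n)) \<le> 1" using assms by (simp add: field_simps)
  have "K \<le> (k - b - c) * (1 + 11 / 10 * b / K) + c * (1 - 3 / (2 * n))"
    using 1 2 assms(3) by (simp add: distrib_left right_diff_distrib)
  moreover have "x * (y / K) + z * (u / K) = (x * y + z * u) / K" for x y z u
    by (simp add: add_divide_distrib)
  moreover have "0 < K" using assms(2) by simp
  ultimately show ?thesis by (simp only: le_divide_eq_1_pos)
qed

text \<open>After scaling by \<open>K\<close>, the raises add at most \<open>11 / 10 * b\<close> in
  total, and the \<open>c\<close> lowered weights take off at least as much.\<close>

lemma incoming_weight_le_1:
  fixes n K b c :: real
  assumes "n > 100" "K \<ge> 1" "b \<ge> 0" "3 * b \<le> n" "b * (2 * n - b - 3) / 2 \<le> c"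
  shows "(K - c) * ((1 + 11 / 10 * b / K) / K) + c * ((1 - 3 / (2 * n)) / K) \<le> 1"
proof -
  \<comment> \<open>From \<open>b \<le> n / 3\<close> the second factor is at least
    \<open>5 / 3 * n - 3\<close>. The constant \<open>22 / 15\<close> is the one for which the
    resulting bound on \<open>c\<close>, times \<open>3 / (2 * n)\<close>, is exactly
    \<open>11 / 10 * b\<close>.\<close>
  have "b * (22 / 15 * n) \<le> b * (2 * n - b - 3)"
    using assms by (intro mult_left_mono) auto
  then have "b * (22 / 15 * n) / 2 \<le> c" using assms(5) by linarith
  then have 1: "11 / 10 * b \<le> c * (3 / (2 * n))" using assms(1) by (simp add: field_simps)
  have "0 \<le> b * (22 / 15 * n) / 2" using assms by simp
  then have "0 \<le> c" using \<open>b * (22 / 15 * n) / 2 \<le> c\<close> by linarith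
  then have 2: "0 \<le> c * (11 / 10 * b / K)" using assms by simp
  have "(K - c) * (1 + 11 / 10 * b / K) = K - c + 11 / 10 * b - c * (11 / 10 * b / K)"
    using assms(2) by (simp add: field_simps)
  then have "(K - c) * (1 + 11 / 10 * b / K) + c * (1 - 3 / (2 * n)) \<le> K"
    using 1 2 by (simp add: right_diff_distrib)
  moreover have "x * (y / K) + z * (u / K) = (x * y + z * u) / K" for x y z u
    by (simp add: add_divide_distrib)
  moreover have "0 < K" using assms(2) by simp
  ultimately show ?thesis by (simp only: divide_le_eq_1_pos)
qed

section \<open>Levels are no larger than their shadows\<close>

text \<open>The bound on \<open>k\<close> keeps at least half of all pairs even on level
  \<open>k - 1\<close>, so the bridge counts apply at both ends of each weighted edge; it also gives
  \<open>k \<ge> K + 1\<close>.\<close>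

lemma card_le_connected_lower_shadow:
  assumes V: "finite V" "card V > 100" and k: "2 * k \<ge> (card V choose 2) + 2"
    and A: "A \<subseteq> {H. H \<subseteq> pairs V \<and> no_empty_cut V H \<and> card H = k}"
  shows "card A \<le> card {G. no_empty_cut V G \<and> (\<exists>H\<in>A. \<exists>e\<in>H. G = H - {e})}"
proof (cases "A = {}")
  case False
  define T where "T = {G. no_empty_cut V G \<and> (\<exists>H\<in>A. \<exists>e\<in>H. G = H - {e})}"
  define n where "n = real (card V)"
  define m where "m = card V choose 2"
  \<comment> \<open>The number of pairs missing from a graph with \<open>k - 1\<close>
    edges.\<close>
  define K where "K = real m - real k + 1"
  define \<beta> where "\<beta> G = card (bridges V G)" for G
  define N where "N H = (\<lambda>e. H - {e}) ` (H - bridges V H)" for H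
  define w where "w H G = (if \<beta> H = \<beta> G then (1 + 11 / 10 * \<beta> G / K) / K
    else (1 - 3 / (2 * n)) / K)" for H G
  have finP: "finite (pairs V)" using V finite_pairs by blast
  have cP: "card (pairs V) = m" using V card_pairs m_def by blast
  have T_sub: "T \<subseteq> Pow (pairs V)" using A by (auto simp: T_def)
  have mreal: "real m = n * (n - 1) / 2" by (simp add: m_def n_def real_choose_two)
  have km: "k \<le> m"
  proof -
    obtain H where "H \<in> A" using False by blast
    then have "H \<subseteq> pairs V" "card H = k" using A by auto
    then show ?thesis using card_mono[OF finP] cP by blast
  qed
  have n100: "n > 100" using V by (simp add: n_def)
  have K1: "K \<ge> 1" using km by (simp add: K_def)
  have "2 * k \<ge> m + 2" using k by (simp add: m_def)
  then have kK: "real k \<ge> K + 1" unfolding K_def by linarith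
  show "card A \<le> card T"
  proof (rule card_le_card_if_weights[where N = N and w = w])
    show "finite A" using A finP by (rule_tac finite_subset[of _ "Pow (pairs V)"]) auto
    show "finite T" using T_sub finP by (rule_tac finite_subset) auto
    show "N H \<subseteq> T" if "H \<in> A" for H
      using that by (auto simp: N_def T_def bridges_def)
    show "1 \<le> (\<Sum>G\<in>N H. w H G)" if "H \<in> A" for H
    proof -
      have H: "H \<subseteq> pairs V" "no_empty_cut V H" "card H = k" using A that by auto
      have finH: "finite H" using H finP finite_subset by blast
      define c where "c = card {e \<in> H - bridges V H. \<beta> (H - {e}) \<noteq> \<beta> H}"
      have "2 * card H \<ge> card V choose 2" using H k by simp
      from card_bridges_and_new_bridge_edges[OF V H(1) this H(2)]
      have bc: "3 * (\<beta> H + c) \<le> 2 * card V" by (simp add: \<beta>_def c_def)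
      have cb: "real (card (H - bridges V H)) = real k - \<beta> H"
        using finH H(3) card_mono[of H "bridges V H"]
        by (subst card_Diff_subset) (auto simp: bridges_def \<beta>_def of_nat_diff)
      have "inj_on (\<lambda>e. H - {e}) (H - bridges V H)" by (auto simp: inj_on_def)
      then have "(\<Sum>G\<in>N H. w H G) = (\<Sum>e\<in>H - bridges V H. w H (H - {e}))"
        by (simp add: N_def sum.reindex)
      also have "\<dots> = (\<Sum>e\<in>H - bridges V H. if \<beta> (H - {e}) = \<beta> H
          then (1 + 11 / 10 * \<beta> H / K) / K else (1 - 3 / (2 * n)) / K)"
        by (intro sum.cong refl) (auto simp: w_def)
      also have "\<dots> = (real k - \<beta> H - c) * ((1 + 11 / 10 * \<beta> H / K) / K) + c * ((1 - 3 / (2 * n)) / K)"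
        using finH cb by (simp add: sum_if_const c_def)
      finally show ?thesis
        using outgoing_weight_ge_1[of n K k "\<beta> H" c] n100 K1 kK mreal bc
        by (simp add: K_def n_def)
    qed
    show "(\<Sum>H | H \<in> A \<and> G \<in> N H. w H G) \<le> 1" if "G \<in> T" for G
    proof -
      obtain H e where He: "H \<in> A" "e \<in> H" "G = H - {e}" using \<open>G \<in> T\<close> by (auto simp: T_def)
      have H: "H \<subseteq> pairs V" "card H = k" using A He by auto
      have G: "G \<subseteq> pairs V" "no_empty_cut V G" using that T_sub by (auto simp: T_def)
      have finG: "finite G" using G finP finite_subset by blast
      have "finite H" using H finP finite_subset by blast
      then have k1: "k = Suc (card G)" using H He card_Suc_Diff1 by metis
      define c where "c = card {e \<in> pairs V - G. \<beta> (insert e G) \<noteq> \<beta> G}"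
      have "2 * card G \<ge> card V choose 2" using k k1 by simp
      from card_bridges_and_killing_pairs[OF V G(1) this G(2)]
      have b3: "3 * \<beta> G \<le> card V"
        and c_ge: "real (\<beta> G) * (2 * real (card V) - real (\<beta> G) - 3) / 2 \<le> real c"
        by (simp_all add: \<beta>_def c_def)
      have cG: "real (card (pairs V - G)) = K"
        using finG G(1) k1 km cP by (subst card_Diff_subset) (auto simp: K_def of_nat_diff)
      \<comment> \<open>Nonnegativity allows the sum over members of \<open>A\<close> above
        \<open>G\<close> to be enlarged to all one-edge extensions of \<open>G\<close>.\<close>
      have nonneg: "w H' G \<ge> 0" for H' using K1 n100 by (simp add: w_def)
      have "(\<Sum>H | H \<in> A \<and> G \<in> N H. w H G) \<le> (\<Sum>H\<in>(\<lambda>e. insert e G) ` (pairs V - G). w H G)"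
      proof (rule sum_mono2)
        show "finite ((\<lambda>e. insert e G) ` (pairs V - G))" using finP by simp
        show "{H. H \<in> A \<and> G \<in> N H} \<subseteq> (\<lambda>e. insert e G) ` (pairs V - G)"
        proof
          fix H assume "H \<in> {H. H \<in> A \<and> G \<in> N H}"
          then obtain e where "H \<in> A" "e \<in> H" "G = H - {e}" by (auto simp: N_def)
          then have "e \<in> pairs V - G" "H = insert e G" using A by auto
          then show "H \<in> (\<lambda>e. insert e G) ` (pairs V - G)" by blast
        qed
      qed (use nonneg in auto)
      also have "\<dots> = (\<Sum>e\<in>pairs V - G. w (insert e G) G)"
      proof -
        have "inj_on (\<lambda>e. insert e G) (pairs V - G)" by (auto simp: inj_on_def)
        then show ?thesis by (simp add: sum.reindex)
      qed
      also have "\<dots> = (\<Sum>e\<in>pairs V - G. if \<beta> (insert e G) = \<beta> G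
          then (1 + 11 / 10 * \<beta> G / K) / K else (1 - 3 / (2 * n)) / K)"
        by (simp add: w_def)
      also have "\<dots> = (K - c) * ((1 + 11 / 10 * \<beta> G / K) / K) + c * ((1 - 3 / (2 * n)) / K)"
        using finP cG by (simp add: sum_if_const c_def)
      also have "\<dots> \<le> 1"
        using incoming_weight_le_1[of n K "\<beta> G" c] n100 K1 b3 c_ge by (simp add: n_def)
      finally show ?thesis .
    qed
  qed
qed simp

text \<open>Uniform weights suffice: each \<open>H\<close> has \<open>card P - k\<close> extensions,
  each \<open>G\<close> at most \<open>k + 1\<close> predecessors, and \<open>2 * k < card P\<close>
  makes the former at least the latter.\<close>

lemma card_le_upper_shadow:
  assumes P: "finite P" and k: "2 * k < card P" and A: "A \<subseteq> {H. H \<subseteq> P \<and> card H = k}"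
  shows "card A \<le> card {G. \<exists>H\<in>A. \<exists>e\<in>P - H. G = insert e H}"
proof -
  define T where "T = {G. \<exists>H\<in>A. \<exists>e\<in>P - H. G = insert e H}"
  define N where "N H = (\<lambda>e. insert e H) ` (P - H)" for H
  define w where "w = (\<lambda>(H :: 'a set) (G :: 'a set). 1 / (real (card P) - real k))"
  have T_sub: "T \<subseteq> Pow P" using A by (auto simp: T_def)
  show "card A \<le> card T"
  proof (rule card_le_card_if_weights[where N = N and w = w])
    show "finite A" using A P by (rule_tac finite_subset[of _ "Pow P"]) auto
    show "finite T" using T_sub P by (rule_tac finite_subset) auto
    show "N H \<subseteq> T" if "H \<in> A" for H using that by (auto simp: N_def T_def)
    show "1 \<le> (\<Sum>G\<in>N H. w H G)" if "H \<in> A" for H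
    proof -
      have H: "H \<subseteq> P" "card H = k" using A that by auto
      have "inj_on (\<lambda>e. insert e H) (P - H)" by (auto simp: inj_on_def)
      then have "card (N H) = card (P - H)" by (simp add: N_def card_image)
      also have "\<dots> = card P - k" using H P finite_subset by (metis card_Diff_subset)
      finally show ?thesis using k by (simp add: w_def of_nat_diff)
    qed
    show "(\<Sum>H | H \<in> A \<and> G \<in> N H. w H G) \<le> 1" if "G \<in> T" for G
    proof -
      obtain H e where He: "H \<in> A" "e \<in> P - H" "G = insert e H" using \<open>G \<in> T\<close> by (auto simp: T_def)
      have "H \<subseteq> P" "card H = k" using A He by auto
      then have G: "finite G" "card G = k + 1" using He P by (auto simp: finite_subset)
      have "{H. H \<in> A \<and> G \<in> N H} \<subseteq> (\<lambda>e. G - {e}) ` G" by (auto simp: N_def image_iff)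
      then have "card {H. H \<in> A \<and> G \<in> N H} \<le> k + 1"
        using G surj_card_le by metis
      then show ?thesis using k by (simp add: w_def field_simps)
    qed
  qed
qed

section \<open>Pushing an antichain into the middle level\<close>

text \<open>\<open>B\<close> is an extreme level and \<open>T\<close> its shadow. A remaining
  element below \<open>T\<close> would by transitivity be below \<open>B\<close>, inside the
  antichain \<open>A\<close>. The order is left abstract so that reversed inclusion serves the
  upward push.\<close>

lemma antichain_in_exchange:
  assumes A: "antichain_in P lt A" "finite A" and B: "B \<subseteq> A"
    and T: "antichain_in P lt T" "finite T" and card: "card B \<le> card T"
    and trans: "\<And>x y z. lt x y \<Longrightarrow> lt y z \<Longrightarrow> lt x z"
    and below: "\<And>y. y \<in> T \<Longrightarrow> \<exists>x\<in>B. lt y x"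
    and not_below: "\<And>y z. y \<in> T \<Longrightarrow> z \<in> A - B \<Longrightarrow> \<not> lt y z"
  shows "antichain_in P lt (A - B \<union> T) \<and> card A \<le> card (A - B \<union> T)"
proof
  have not_above: "\<not> lt z y" if yz: "y \<in> T" "z \<in> A - B" for y z
  proof
    assume "lt z y"
    obtain x where "x \<in> B" "lt y x" using below yz by blast
    then have "lt z x" "x \<in> A" "x \<noteq> z" using trans \<open>lt z y\<close> B yz by auto
    then show False using A yz by (auto simp: antichain_in_def)
  qed
  show "antichain_in P lt (A - B \<union> T)"
    unfolding antichain_in_def
  proof (intro conjI[of "_ \<subseteq> _"] ballI impI)
    show "A - B \<union> T \<subseteq> P" using A T by (auto simp: antichain_in_def)
    fix x y assume "x \<in> A - B \<union> T" "y \<in> A - B \<union> T" "x \<noteq> y"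
    then consider "x \<in> A" "y \<in> A" | "x \<in> T" "y \<in> T" | "x \<in> A - B" "y \<in> T" | "x \<in> T" "y \<in> A - B"
      by blast
    then show "\<not> lt x y \<and> \<not> lt y x"
      using A(1) T(1) not_below not_above \<open>x \<noteq> y\<close> by cases (simp_all add: antichain_in_def)
  qed
  \<comment> \<open>A common element would remain in \<open>A\<close> while lying below an element
    of \<open>B\<close>.\<close>
  have disj: "(A - B) \<inter> T = {}"
  proof (rule ccontr)
    assume "(A - B) \<inter> T \<noteq> {}"
    then obtain y where y: "y \<in> A" "y \<notin> B" "y \<in> T" by blast
    then obtain x where "x \<in> B" "lt y x" using below by blast
    then show False using y B A(1) by (auto simp: antichain_in_def)
  qed
  have "card A = card (A - B) + card B"
    using A(2) B by (metis card_Diff_subset card_mono finite_subset le_add_diff_inverse2)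
  also have "\<dots> \<le> card (A - B \<union> T)" using A(2) T(2) disj card by (simp add: card_Un_disjoint)
  finally show "card A \<le> card (A - B \<union> T)" .
qed

lemma antichain_in_if_same_card:
  "T \<subseteq> P \<Longrightarrow> (\<And>x. x \<in> T \<Longrightarrow> finite x \<and> card x = k) \<Longrightarrow> antichain_in P (\<subset>) T"
  unfolding antichain_in_def by (metis order_less_irrefl psubset_card_mono)

lemma connected_graphs_iff:
  assumes "n > 0"
  shows "E \<in> connected_graphs n \<longleftrightarrow> E \<subseteq> pairs {1..n} \<and> no_empty_cut {1..n} E"
  using assms graph_connected_iff[of E "{1..n}"]
  by (auto simp: connected_graphs_def simple_graph_on_iff)

text \<open>\<open>d\<close> bounds how many levels above \<open>M\<close> may be occupied; each
  step trades the topmost for its connected shadow. That level is at least \<open>M + 1\<close>,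
  which is what the lower shadow bound asks for.\<close>

lemma push_antichain_down:
  assumes n: "n > 100" and M: "2 * M \<ge> n choose 2"
    and A: "antichain_in (connected_graphs n) (\<subset>) A" and bound: "\<And>H. H \<in> A \<Longrightarrow> card H \<le> M + d"
  shows "\<exists>A'. antichain_in (connected_graphs n) (\<subset>) A' \<and> card A \<le> card A' \<and> (\<forall>H\<in>A'. card H \<le> M)"
  using A bound
proof (induction d arbitrary: A)
  case 0
  then show ?case by auto
next
  case (Suc d)
  define k where "k = M + Suc d"
  define V where "V = {1..n}"
  define B where "B = {H \<in> A. card H = k}"
  define T where "T = {G. no_empty_cut V G \<and> (\<exists>H\<in>B. \<exists>e\<in>H. G = H - {e})}"
  have V: "finite V" "card V = n" by (simp_all add: V_def)
  have conn: "E \<in> connected_graphs n \<longleftrightarrow> E \<subseteq> pairs V \<and> no_empty_cut V E" for E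
    using connected_graphs_iff n V_def by simp
  have A_sub: "A \<subseteq> connected_graphs n" using Suc.prems(1) by (simp add: antichain_in_def)
  have finE: "finite E" if "E \<in> connected_graphs n" for E
    using that conn V finite_pairs finite_subset by metis
  have T_sub: "T \<subseteq> connected_graphs n"
  proof
    fix G assume "G \<in> T"
    then obtain H e where G: "no_empty_cut V G" "H \<in> A" "G = H - {e}" by (auto simp: T_def B_def)
    then have "H \<subseteq> pairs V" using A_sub conn by blast
    then show "G \<in> connected_graphs n" using G unfolding conn by blast
  qed
  have cT: "Suc (card G) = k" if "G \<in> T" for G
    using that A_sub finE card_Suc_Diff1 unfolding T_def B_def by fastforce
  have B_sub: "B \<subseteq> {H. H \<subseteq> pairs V \<and> no_empty_cut V H \<and> card H = k}"
    using A_sub conn unfolding B_def by blast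
  have le: "card B \<le> card T"
    unfolding T_def using M n V B_sub
    by (intro card_le_connected_lower_shadow[where k = k]) (simp_all add: k_def)
  have exch: "antichain_in (connected_graphs n) (\<subset>) (A - B \<union> T) \<and> card A \<le> card (A - B \<union> T)"
  proof (rule antichain_in_exchange[OF Suc.prems(1)])
    show "finite A" using A_sub finite_connected_graphs finite_subset by blast
    show "finite T" using T_sub finite_connected_graphs finite_subset by blast
    show "antichain_in (connected_graphs n) (\<subset>) T"
    proof (rule antichain_in_if_same_card[OF T_sub])
      show "finite G \<and> card G = k - 1" if "G \<in> T" for G using cT[OF that] that T_sub finE by auto
    qed
    show "\<exists>x\<in>B. y \<subset> x" if "y \<in> T" for y using that by (auto simp: T_def)
    show "\<not> y \<subset> z" if "y \<in> T" "z \<in> A - B" for y z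
    proof -
      \<comment> \<open>Shadow elements have \<open>k - 1\<close> edges, and so at most do the
        graphs that remain.\<close>
      have "card z \<le> card y"
        using cT[OF that(1)] that(2) Suc.prems(2)[of z] by (auto simp: B_def k_def)
      moreover have "finite z" using that A_sub finE by auto
      ultimately show "\<not> y \<subset> z" using psubset_card_mono leD by blast
    qed
  qed (use le in \<open>auto simp: B_def\<close>)
  have "card H \<le> M + d" if "H \<in> A - B \<union> T" for H
    using that cT[of H] Suc.prems(2)[of H] by (auto simp: B_def k_def)
  from Suc.IH[OF exch[THEN conjunct1] this] show ?case using exch order.trans by blast
qed

text \<open>The mirror image from below: the shadow stays connected automatically, so the plain
  degree count suffices.\<close>

lemma push_antichain_up:
  assumes n: "n > 0" and M: "2 * M \<le> (n choose 2) + 1"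
    and A: "antichain_in (connected_graphs n) (\<subset>) A"
    and bound: "\<And>H. H \<in> A \<Longrightarrow> M \<le> card H + d \<and> card H \<le> M"
  shows "\<exists>A'. antichain_in (connected_graphs n) (\<subset>) A' \<and> card A \<le> card A' \<and> (\<forall>H\<in>A'. card H = M)"
  using A bound
proof (induction d arbitrary: A)
  case 0
  then show ?case by (intro exI[of _ A]) (auto intro: antisym)
next
  case (Suc d)
  define V where "V = {1..n}"
  define B where "B = {H \<in> A. card H + Suc d = M}"
  define T where "T = {G. \<exists>H\<in>B. \<exists>e\<in>pairs V - H. G = insert e H}"
  have V: "finite V" "card V = n" by (simp_all add: V_def)
  have conn: "E \<in> connected_graphs n \<longleftrightarrow> E \<subseteq> pairs V \<and> no_empty_cut V E" for E
    using connected_graphs_iff n V_def by simp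
  have A_sub: "A \<subseteq> connected_graphs n" using Suc.prems(1) by (simp add: antichain_in_def)
  have finE: "finite E" if "E \<in> connected_graphs n" for E
    using that conn V finite_pairs finite_subset by metis
  have T_sub: "T \<subseteq> connected_graphs n"
  proof
    fix G assume "G \<in> T"
    then obtain H e where G: "H \<in> A" "e \<in> pairs V" "G = insert e H" by (auto simp: T_def B_def)
    then have H: "H \<subseteq> pairs V" "no_empty_cut V H" using A_sub conn by blast+
    then have "no_empty_cut V G" using G no_empty_cut_mono[of V H G] by blast
    then show "G \<in> connected_graphs n" using G H unfolding conn by blast
  qed
  have cT: "card G + d = M" if "G \<in> T" for G
    using that A_sub finE unfolding T_def B_def by fastforce
  have flip: "antichain_in P (\<lambda>x y. y \<subset> x) S \<longleftrightarrow> antichain_in P (\<subset>) S" for P and S :: "nat set set set"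
    by (auto simp: antichain_in_def)
  have le: "card B \<le> card T"
  proof (cases "B = {}")
    case False
    \<comment> \<open>A member of \<open>B\<close> shows that this subtraction is not truncated;
      then \<open>2 * M \<le> m + 1\<close> puts the level strictly below half of all pairs.\<close>
    then have "M - Suc d + Suc d = M" by (auto simp: B_def)
    then have "2 * (M - Suc d) < card (pairs V)"
      using M V by (simp add: card_pairs)
    moreover have "B \<subseteq> {H. H \<subseteq> pairs V \<and> card H = M - Suc d}"
      using A_sub conn unfolding B_def by fastforce
    ultimately show ?thesis
      unfolding T_def using V
      by (intro card_le_upper_shadow[where k = "M - Suc d"]) (simp_all add: finite_pairs)
  qed simp
  have exch: "antichain_in (connected_graphs n) (\<lambda>x y. y \<subset> x) (A - B \<union> T) \<and> card A \<le> card (A - B \<union> T)"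
  proof (rule antichain_in_exchange[of _ "\<lambda>x y. y \<subset> x"])
    show "antichain_in (connected_graphs n) (\<lambda>x y. y \<subset> x) A" using Suc.prems(1) by (simp add: flip)
    show "finite A" using A_sub finite_connected_graphs finite_subset by blast
    show "finite T" using T_sub finite_connected_graphs finite_subset by blast
    show "antichain_in (connected_graphs n) (\<lambda>x y. y \<subset> x) T"
      unfolding flip
    proof (rule antichain_in_if_same_card[OF T_sub])
      show "finite G \<and> card G = M - d" if "G \<in> T" for G using cT[OF that] that T_sub finE by auto
    qed
    show "\<exists>x\<in>B. x \<subset> y" if "y \<in> T" for y using that by (auto simp: T_def)
    show "\<not> z \<subset> y" if "y \<in> T" "z \<in> A - B" for y z
    proof -
      have "card y \<le> card z"
        using cT[OF that(1)] that(2) Suc.prems(2)[of z] by (auto simp: B_def)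
      moreover have "finite y" using that T_sub finE by auto
      ultimately show "\<not> z \<subset> y" using psubset_card_mono leD by blast
    qed
  qed (use le in \<open>auto simp: B_def\<close>)
  have "M \<le> card H + d \<and> card H \<le> M" if "H \<in> A - B \<union> T" for H
    using that cT[of H] Suc.prems(2)[of H] by (auto simp: B_def)
  from Suc.IH[OF exch[THEN conjunct1, unfolded flip] this] show ?case using exch order.trans by blast
qed

theorem theorem1p2:
  shows "\<exists>n0::nat. \<forall>n>n0.
    (let m = n choose 2;
         M = nat \<lceil>real m / 2\<rceil>
     in antichain_in (connected_graphs n) (\<subset>) (connected_graphs_level n M) \<and>
        (\<forall>A. antichain_in (connected_graphs n) (\<subset>) A \<longrightarrow>
             card A \<le> card (connected_graphs_level n M)))"
proof (intro exI[of _ 100] allI impI)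
  fix n :: nat
  \<comment> \<open>The value 100 is generous: the cut count uses \<open>n > 81\<close>, and the
    weight estimates hold already for smaller \<open>n\<close>.\<close>
  assume n: "n > 100"
  define m where "m = n choose 2"
  define M where "M = nat \<lceil>real m / 2\<rceil>"
  \<comment> \<open>The first bound drives the push down, the second the push up.\<close>
  have M: "2 * M \<ge> m" "2 * M \<le> m + 1" unfolding M_def by linarith+
  have finE: "finite E" "card E \<le> m" if "E \<in> connected_graphs n" for E
  proof -
    have "E \<subseteq> pairs {1..n}" using that n by (simp add: connected_graphs_iff)
    then show "finite E" "card E \<le> m"
      using finite_subset card_mono finite_pairs[of "{1..n}"] card_pairs[of "{1..n}"]
      unfolding m_def by fastforce+
  qed
  have "antichain_in (connected_graphs n) (\<subset>) (connected_graphs_level n M)"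
    by (rule antichain_in_if_same_card[where k = M]) (auto simp: connected_graphs_level_def finE)
  moreover have "card A \<le> card (connected_graphs_level n M)"
    if A: "antichain_in (connected_graphs n) (\<subset>) A" for A
  proof -
    \<comment> \<open>A crude number of levels is enough: \<open>m\<close> above \<open>M\<close>
      here, and \<open>M\<close> below it in the upward push.\<close>
    have "card H \<le> M + m" if "H \<in> A" for H
      using that A finE(2)[of H] by (auto simp: antichain_in_def)
    from push_antichain_down[OF n M(1)[unfolded m_def] A this]
    obtain A' where A': "antichain_in (connected_graphs n) (\<subset>) A'" "card A \<le> card A'"
        "\<forall>H\<in>A'. card H \<le> M" by blast
    then obtain A'' where A'': "antichain_in (connected_graphs n) (\<subset>) A''" "card A' \<le> card A''"
        "\<forall>H\<in>A''. card H = M"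
      using push_antichain_up[of n M A' M] n M(2) by (auto simp: m_def)
    have "A'' \<subseteq> connected_graphs_level n M"
      using A'' by (auto simp: antichain_in_def connected_graphs_level_def)
    moreover have "finite (connected_graphs_level n M)"
      using finite_connected_graphs by (simp add: connected_graphs_level_def)
    ultimately show ?thesis using A'(2) A''(2) card_mono order.trans by metis
  qed
  ultimately show "let m = n choose 2; M = nat \<lceil>real m / 2\<rceil>
     in antichain_in (connected_graphs n) (\<subset>) (connected_graphs_level n M) \<and>
        (\<forall>A. antichain_in (connected_graphs n) (\<subset>) A \<longrightarrow>
             card A \<le> card (connected_graphs_level n M))"
    by (simp add: Let_def m_def M_def)
qed

end
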